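(* Let $X$ be a finite set with at least three elements, let $n\ge 2$ be an integer, $N(n)=\{1,\dots,n\}$, and let $\mathcal{D}^{N(n)}_{\text{Strict Condorcet}}$ be the set of all preference profiles $R_{N(n)}\in\mathcal{L}^{N(n)}$ at which there is a strict Condorcet-winner. Let $f$ be a choice function with domain $\mathcal{D}^{N(n)}_{\text{Strict Condorcet}}$. Then $f$ satisfies Global Independence of Irrelevant Alternatives (GIIA) and Most Probable at the Top (MPT) if and only if $f$ is the Strict-Condorcet Rule, i.e. for every $R_{N(n)}\in\mathcal{D}^{N(n)}_{\text{Strict Condorcet}}$, $f(R_{N(n)})=\{x\}$ where $x$ is the unique strict Condorcet-winner at $R_{N(n)}$.
   Context: $X$ is the finite set of alternatives, $|X|\ge 3$; $N(n)=\{1,\dots,n\}$, $n\ge2$, is the set of states of nature. A strict ranking on $X$ is a reflexive, complete, transitive and antisymmetric binary relation $R$ on $X$; $xRy$ means $(x,y)\in R$, and for $x\ne y$ it is read "$x$ is strictly preferred to $y$". $\mathcal{L}$ is the set of all strict rankings on $X$. A preference profile is a function $R_{N(n)}=\langle R_i \mid i\in N(n)\rangle$ from $N(n)$ to $\mathcal{L}$; $\mathcal{L}^{N(n)}$ is the set of all preference profiles. $R_i|A$ denotes the restriction of $R_i$ to a subset $A\subset X$. A choice function (CF) on a non-empty set $\mathcal{D}\subset\mathcal{L}^{N(n)}$ is a function $f$ from $\mathcal{D}$ to the set of all non-empty subsets of $X$. An alternative $x$ is a strict Condorcet-winner at $R_{N(n)}$ if for all $y\in X\setminus\{x\}$, $|\{i\in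 N(n): xR_iy\}|>|\{i\in N(n): yR_ix\}|$. A strict Condorcet-winner, if it exists, is unique. GIIA: a CF $f$ on $\mathcal{D}$ satisfies Global Independence of Irrelevant Alternatives if for all $R_{N(n)},R'_{N(n)}\in\mathcal{D}$ and all $x,y\in X$ with $x\neq y$: if $R_i|\{x,y\}=R'_i|\{x,y\}$ for all $i\in N(n)$, $x\in f(R_{N(n)})$ and $y\notin f(R_{N(n)})$, then $y\notin f(R'_{N(n)})$. MPT: a CF $f$ on $\mathcal{D}$ satisfies Most Probable at the Top if for all $R_{N(n)}\in\mathcal{D}$ and all $x,y\in X$ with $x\ne y$ such that $xR_iw$ and $yR_iw$ for all $i\in N(n)$ and all $w\in X\setminus\{x,y\}$: if $|\{i\in N(n): xR_iy\}|>|\{i\in N(n): yR_ix\}|$, then $f(R_{N(n)})=\{x\}$. *)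

theory Defs
  imports Main "HOL-Library.FuncSet"
begin

definition strict_rankings :: "'a set \<Rightarrow> ('a \<times> 'a) set set" where
  "strict_rankings X = {R. linear_order_on X R}"

text \<open>States range over \<open>{1..n}\<close>. Profiles are extensional functions, so that two profiles
  agreeing on all states are equal.\<close>

definition profiles :: "'a set \<Rightarrow> nat \<Rightarrow> (nat \<Rightarrow> ('a \<times> 'a) set) set" where
  "profiles X n = {1..n} \<rightarrow>\<^sub>E strict_rankings X"

definition choice_function ::
  "'a set \<Rightarrow> nat \<Rightarrow> (nat \<Rightarrow> ('a \<times> 'a) set) set \<Rightarrow> ((nat \<Rightarrow> ('a \<times> 'a) set) \<Rightarrow> 'a set) \<Rightarrow> bool" where
  "choice_function X n D f \<longleftrightarrow>
     D \<noteq> {} \<and> D \<subseteq> profiles X n \<and> f \<in> D \<rightarrow> {A. A \<subseteq> X \<and> A \<noteq> {}}"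

definition support :: "nat \<Rightarrow> (nat \<Rightarrow> ('a \<times> 'a) set) \<Rightarrow> 'a \<Rightarrow> 'a \<Rightarrow> nat" where
  "support n R x y = card {i \<in> {1..n}. (x, y) \<in> R i}"

definition strict_condorcet_winner ::
  "'a set \<Rightarrow> nat \<Rightarrow> (nat \<Rightarrow> ('a \<times> 'a) set) \<Rightarrow> 'a \<Rightarrow> bool" where
  "strict_condorcet_winner X n R x \<longleftrightarrow>
     x \<in> X \<and> (\<forall>y \<in> X - {x}. support n R x y > support n R y x)"

definition strict_condorcet_domain ::
  "'a set \<Rightarrow> nat \<Rightarrow> (nat \<Rightarrow> ('a \<times> 'a) set) set" where
  "strict_condorcet_domain X n = {R \<in> profiles X n. \<exists>x. strict_condorcet_winner X n R x}"

definition GIIA ::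
  "'a set \<Rightarrow> nat \<Rightarrow> (nat \<Rightarrow> ('a \<times> 'a) set) set \<Rightarrow> ((nat \<Rightarrow> ('a \<times> 'a) set) \<Rightarrow> 'a set) \<Rightarrow> bool" where
  "GIIA X n D f \<longleftrightarrow>
     (\<forall>R \<in> D. \<forall>R' \<in> D. \<forall>x \<in> X. \<forall>y \<in> X. x \<noteq> y \<longrightarrow>
        (\<forall>i \<in> {1..n}. Restr (R i) {x, y} = Restr (R' i) {x, y}) \<longrightarrow>
        x \<in> f R \<longrightarrow> y \<notin> f R \<longrightarrow> y \<notin> f R')"

definition MPT ::
  "'a set \<Rightarrow> nat \<Rightarrow> (nat \<Rightarrow> ('a \<times> 'a) set) set \<Rightarrow> ((nat \<Rightarrow> ('a \<times> 'a) set) \<Rightarrow> 'a set) \<Rightarrow> bool" where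
  "MPT X n D f \<longleftrightarrow>
     (\<forall>R \<in> D. \<forall>x \<in> X. \<forall>y \<in> X. x \<noteq> y \<longrightarrow>
        (\<forall>i \<in> {1..n}. \<forall>w \<in> X - {x, y}. (x, w) \<in> R i \<and> (y, w) \<in> R i) \<longrightarrow>
        support n R x y > support n R y x \<longrightarrow> f R = {x})"

lemma strict_condorcet_winner_unique:
  assumes "strict_condorcet_winner X n R x" "strict_condorcet_winner X n R y"
  shows "x = y"
proof (rule ccontr)
  assume "x \<noteq> y"
  with assms have "support n R x y > support n R y x" "support n R y x > support n R x y"
    by (auto simp: strict_condorcet_winner_def)
  then show False by simp
qed

definition is_strict_condorcet_rule ::
  "'a set \<Rightarrow> nat \<Rightarrow> ((nat \<Rightarrow> ('a \<times> 'a) set) \<Rightarrow> 'a set) \<Rightarrow> bool" where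
  "is_strict_condorcet_rule X n f \<longleftrightarrow>
     (\<forall>R \<in> strict_condorcet_domain X n. \<exists>x. strict_condorcet_winner X n R x \<and> f R = {x})"

end

theory Submission
  imports Defs
begin

text \<open>
  If \<open>x\<close> is the strict Condorcet winner at \<open>R\<close> and \<open>y \<noteq> x\<close>, move \<open>x\<close> and \<open>y\<close> to the two top positions
  of every ranking, keeping their relative order. At the new profile \<open>x\<close> is still the strict
  Condorcet winner, so the profile lies in the domain and MPT forces the choice \<open>{x}\<close>. GIIA then
  excludes \<open>y\<close> from the choice at \<open>R\<close>.
\<close>

text \<open>A lexicographic order: membership in \<open>A\<close> is compared first, then
  \<open>r\<close> breaks the tie. The cut to \<open>X \<times> X\<close> keeps it a relation on
  \<open>X\<close> for an arbitrary set \<open>A\<close>.\<close>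

definition lift_top :: "'a set \<Rightarrow> 'a set \<Rightarrow> ('a \<times> 'a) set \<Rightarrow> ('a \<times> 'a) set" where
  "lift_top X A r = {(a, b) \<in> X \<times> X. (a \<in> A \<and> b \<notin> A) \<or> ((a \<in> A \<longleftrightarrow> b \<in> A) \<and> (a, b) \<in> r)}"

lemma linear_order_lift_top:
  assumes "linear_order_on X r"
  shows "linear_order_on X (lift_top X A r)"
proof -
  have refl: "\<And>a. a \<in> X \<Longrightarrow> (a, a) \<in> r"
    and tr: "\<And>a b c. (a, b) \<in> r \<Longrightarrow> (b, c) \<in> r \<Longrightarrow> (a, c) \<in> r"
    and anti: "\<And>a b. (a, b) \<in> r \<Longrightarrow> (b, a) \<in> r \<Longrightarrow> a = b"
    and tot: "\<And>a b. a \<in> X \<Longrightarrow> b \<in> X \<Longrightarrow> a \<noteq> b \<Longrightarrow> (a, b) \<in> r \<or> (b, a) \<in> r"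
    using assms unfolding order_on_defs total_on_def antisym_def
    by (blast dest: refl_onD transD)+
  show ?thesis
    unfolding order_on_defs refl_on_def trans_def antisym_def total_on_def lift_top_def
    by (auto intro: refl dest: tr anti tot)
qed

text \<open>The restricted lambda makes the result extensional, as membership in
  \<open>profiles\<close> demands.\<close>

definition lift_profile ::
  "'a set \<Rightarrow> nat \<Rightarrow> 'a set \<Rightarrow> (nat \<Rightarrow> ('a \<times> 'a) set) \<Rightarrow> nat \<Rightarrow> ('a \<times> 'a) set" where
  "lift_profile X n A R = (\<lambda>i\<in>{1..n}. lift_top X A (R i))"

lemma profile_linear_order:
  assumes "R \<in> profiles X n" "i \<in> {1..n}"
  shows "linear_order_on X (R i)"
  using PiE_mem[of R "{1..n}" "\<lambda>_. strict_rankings X" i] assms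
  by (simp add: profiles_def strict_rankings_def)

lemma lift_profile_in_profiles:
  assumes "R \<in> profiles X n"
  shows "lift_profile X n A R \<in> profiles X n"
  unfolding profiles_def lift_profile_def
proof (rule restrict_PiE_iff[THEN iffD2], rule ballI)
  fix i assume "i \<in> {1..n}"
  then show "lift_top X A (R i) \<in> strict_rankings X"
    using assms by (simp add: strict_rankings_def linear_order_lift_top profile_linear_order)
qed

lemma Restr_lift_profile:
  assumes "R \<in> profiles X n" "i \<in> {1..n}"
  shows "Restr (lift_profile X n A R i) A = Restr (R i) A"
proof -
  \<comment> \<open>\<open>lift_top\<close> drops every pair outside \<open>X \<times> X\<close>;
    equality on \<open>A\<close> therefore needs \<open>R i\<close> to have no such pair.\<close>
  have "R i \<subseteq> X \<times> X"
    using profile_linear_order[OF assms] by (simp add: order_on_defs)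
  then show ?thesis
    using assms(2) by (auto simp: lift_profile_def lift_top_def)
qed

text \<open>Carries the agreement hypothesis of GIIA over to majority counts: the restrictions to
  \<open>A\<close> already decide in which states \<open>x\<close> is ranked above
  \<open>y\<close>.\<close>

lemma support_cong_Restr:
  assumes "\<forall>i \<in> {1..n}. Restr (R i) A = Restr (R' i) A" "x \<in> A" "y \<in> A"
  shows "support n R x y = support n R' x y"
proof -
  have "(x, y) \<in> R i \<longleftrightarrow> (x, y) \<in> R' i" if "i \<in> {1..n}" for i
    using assms that by blast
  then have "{i \<in> {1..n}. (x, y) \<in> R i} = {i \<in> {1..n}. (x, y) \<in> R' i}"
    by blast
  then show ?thesis
    by (simp add: support_def)
qed

lemma support_unanimous:
  assumes "R \<in> profiles X n" "x \<noteq> w" "\<forall>i \<in> {1..n}. (x, w) \<in> R i"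
  shows "support n R x w = n" "support n R w x = 0"
proof -
  have "{i \<in> {1..n}. (x, w) \<in> R i} = {1..n}"
    using assms(3) by blast
  then show "support n R x w = n"
    by (simp add: support_def)
  have "(w, x) \<notin> R i" if "i \<in> {1..n}" for i
  proof -
    have "antisym (R i)"
      using profile_linear_order[OF assms(1) that] by (simp add: order_on_defs)
    then show ?thesis
      using assms(2,3) that by (auto dest: antisymD)
  qed
  then have "{i \<in> {1..n}. (w, x) \<in> R i} = {}"
    by blast
  then show "support n R w x = 0"
    by (simp add: support_def)
qed

text \<open>The only serious rival of \<open>x\<close> is \<open>y\<close>, which loses by
  assumption; any other alternative loses by \<open>n\<close> votes to 0, a strict majority because
  \<open>n > 0\<close>. This serves both directions: it identifies the winner in the situation of
  MPT, and it keeps the lifted profile inside the domain.\<close>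

lemma strict_condorcet_winner_top_pair:
  assumes "R \<in> profiles X n" "n > 0" "x \<in> X"
    and "\<forall>i \<in> {1..n}. \<forall>w \<in> X - {x, y}. (x, w) \<in> R i"
    and "support n R x y > support n R y x"
  shows "strict_condorcet_winner X n R x"
  unfolding strict_condorcet_winner_def
proof (intro conjI ballI)
  show "x \<in> X" by fact
next
  fix w assume w: "w \<in> X - {x}"
  show "support n R w x < support n R x w"
  proof (cases "w = y")
    case False
    then show ?thesis
      using w assms(2,4) support_unanimous[OF assms(1), of x w] by auto
  qed (use assms(5) in simp)
qed

lemma condorcet_rule_choice:
  assumes "is_strict_condorcet_rule X n f" "R \<in> profiles X n" "strict_condorcet_winner X n R x"
  shows "f R = {x}"
proof -
  have "R \<in> strict_condorcet_domain X n"
    using assms(2,3) by (auto simp: strict_condorcet_domain_def)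
  then obtain z where "strict_condorcet_winner X n R z" "f R = {z}"
    using assms(1) unfolding is_strict_condorcet_rule_def by blast
  then show ?thesis
    using strict_condorcet_winner_unique[OF assms(3)] by simp
qed

text \<open>If \<open>x\<close> is chosen at \<open>R\<close> and \<open>y\<close> at
  \<open>R'\<close>, each is the winner there, so the majority between them is reversed from
  \<open>R\<close> to \<open>R'\<close>. Agreement on \<open>{x, y}\<close> makes the counts equal,
  a contradiction.\<close>

lemma condorcet_rule_GIIA:
  assumes "is_strict_condorcet_rule X n f"
  shows "GIIA X n (strict_condorcet_domain X n) f"
  unfolding GIIA_def
proof (intro ballI impI notI)
  fix R R' x y
  assume R: "R \<in> strict_condorcet_domain X n" and R': "R' \<in> strict_condorcet_domain X n"
    and xy: "x \<in> X" "y \<in> X" "x \<noteq> y"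
    and agree: "\<forall>i \<in> {1..n}. Restr (R i) {x, y} = Restr (R' i) {x, y}"
    and mem: "x \<in> f R" "y \<in> f R'"
  have "strict_condorcet_winner X n R x" "strict_condorcet_winner X n R' y"
    using assms R R' mem by (auto simp: is_strict_condorcet_rule_def)
  then have "support n R x y > support n R y x" "support n R' y x > support n R' x y"
    using xy by (auto simp: strict_condorcet_winner_def)
  then show False
    using support_cong_Restr[OF agree, of x y] support_cong_Restr[OF agree, of y x] by simp
qed

lemma condorcet_rule_MPT:
  assumes "is_strict_condorcet_rule X n f" "n > 0"
  shows "MPT X n (strict_condorcet_domain X n) f"
  unfolding MPT_def
proof (intro ballI impI)
  fix R x y
  assume R: "R \<in> strict_condorcet_domain X n" and x: "x \<in> X"
    and top: "\<forall>i \<in> {1..n}. \<forall>w \<in> X - {x, y}. (x, w) \<in> R i \<and> (y, w) \<in> R i"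
    and beats: "support n R y x < support n R x y"
  have P: "R \<in> profiles X n"
    using R by (simp add: strict_condorcet_domain_def)
  have "strict_condorcet_winner X n R x"
    using strict_condorcet_winner_top_pair[OF P assms(2) x _ beats] top by simp
  then show "f R = {x}"
    using condorcet_rule_choice[OF assms(1) P] by simp
qed

lemma loser_not_chosen:
  assumes "GIIA X n (strict_condorcet_domain X n) f" "MPT X n (strict_condorcet_domain X n) f"
    and "n > 0" "R \<in> profiles X n" "strict_condorcet_winner X n R x" "y \<in> X" "y \<noteq> x"
  shows "y \<notin> f R"
proof -
  define R' where "R' = lift_profile X n {x, y} R"
  have P': "R' \<in> profiles X n"
    using assms(4) by (simp add: R'_def lift_profile_in_profiles)
  have agree: "\<forall>i \<in> {1..n}. Restr (R' i) {x, y} = Restr (R i) {x, y}"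
    using assms(4) Restr_lift_profile unfolding R'_def by blast
  have x: "x \<in> X" and "support n R x y > support n R y x"
    using assms(5-7) by (auto simp: strict_condorcet_winner_def)
  then have beats: "support n R' x y > support n R' y x"
    using support_cong_Restr[OF agree, of x y] support_cong_Restr[OF agree, of y x] by simp
  have top: "\<forall>i \<in> {1..n}. \<forall>w \<in> X - {x, y}. (x, w) \<in> R' i \<and> (y, w) \<in> R' i"
    using x assms(6) by (auto simp: R'_def lift_profile_def lift_top_def)
  have "strict_condorcet_winner X n R' x"
    using strict_condorcet_winner_top_pair[OF P' assms(3) x _ beats] top by simp
  \<comment> \<open>Both axioms speak only about profiles in the domain, so this must be known
    before either is applied to \<open>R'\<close>.\<close>
  then have D': "R' \<in> strict_condorcet_domain X n"
    using P' by (auto simp: strict_condorcet_domain_def)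
  have D: "R \<in> strict_condorcet_domain X n"
    using assms(4,5) by (auto simp: strict_condorcet_domain_def)
  have "f R' = {x}"
    using assms(2,6,7) D' x top beats unfolding MPT_def by metis
  then have "x \<in> f R'" "y \<notin> f R'"
    using assms(7) by auto
  \<comment> \<open>GIIA is used from the lifted profile back to the original one: \<open>x\<close>
    chosen and \<open>y\<close> rejected at \<open>R'\<close> gives \<open>y\<close> rejected at
    \<open>R\<close>.\<close>
  then show ?thesis
    using assms(1,6,7) D D' x agree unfolding GIIA_def by metis
qed

theorem theorem2:
  fixes X :: "'a set" and n :: nat
    and f :: "(nat \<Rightarrow> ('a \<times> 'a) set) \<Rightarrow> 'a set"
  assumes "finite X" and "card X \<ge> 3" and "n \<ge> 2"
    and "choice_function X n (strict_condorcet_domain X n) f"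
  shows "GIIA X n (strict_condorcet_domain X n) f \<and> MPT X n (strict_condorcet_domain X n) f
    \<longleftrightarrow> is_strict_condorcet_rule X n f"
proof
  have n: "n > 0"
    using assms(3) by simp
  show "GIIA X n (strict_condorcet_domain X n) f \<and> MPT X n (strict_condorcet_domain X n) f"
    if "is_strict_condorcet_rule X n f"
    using that n condorcet_rule_GIIA condorcet_rule_MPT by blast
  assume ax: "GIIA X n (strict_condorcet_domain X n) f \<and> MPT X n (strict_condorcet_domain X n) f"
  show "is_strict_condorcet_rule X n f"
    unfolding is_strict_condorcet_rule_def
  proof
    fix R assume R: "R \<in> strict_condorcet_domain X n"
    then obtain x where P: "R \<in> profiles X n" and x: "strict_condorcet_winner X n R x"
      by (auto simp: strict_condorcet_domain_def)
    \<comment> \<open>Rejecting all losers only yields that \<open>f R\<close> is contained in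
      \<open>{x}\<close>; non-emptiness of the choice then forces equality.\<close>
    have "f R \<subseteq> X" "f R \<noteq> {}"
      using assms(4) R by (auto simp: choice_function_def)
    moreover have "y \<notin> f R" if "y \<in> X" "y \<noteq> x" for y
      using loser_not_chosen[OF _ _ n P x that] ax by simp
    ultimately have "f R = {x}"
      by blast
    then show "\<exists>x. strict_condorcet_winner X n R x \<and> f R = {x}"
      using x by blast
  qed
qed

end
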